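(* Let $p$ be a prime. The cardinalities $|N_\infty(C_{p^n})|$ satisfy the recurrence relation \begin{align*} |N_\infty(C_{p^{-1}})| &= 1,\\ |N_\infty(C_{p^{n}})| &= \sum_{i=0}^{n} |N_\infty(C_{p^{i-1}})|\,|N_\infty(C_{p^{n-i-1}})| \quad \text{for } n \geq 0. \end{align*} In particular, $|N_\infty(C_{p^n})| = \mathsf{Cat}(n+1)$, where $\mathsf{Cat}(m) = \frac{(2m)!}{(m+1)!\,m!}$ is the $m$-th Catalan number.
   Context: $N_\infty(G)$ denotes the set of homotopy classes of $N_\infty$-operads for a finite group $G$. For $G = C_{p^n}$ with $n \geq 0$ its elements are identified with transfer systems, described by sets of norm maps as follows. An element $X \in N_\infty(C_{p^n})$ is a set of symbols $N_i^j$ with $0 \leq i < j \leq n$ (the symbol $N_i^j$ stands for a norm map from the subgroup $C_{p^i}$ to the subgroup $C_{p^j}$; the identity norms $N_i^i$ are regarded as always present and are not written) such that: (Restriction) if $N_i^j \in X$ and $i < k < j$, then $N_i^k \in X$; (Composition) if $N_i^j \in X$ and $N_j^k \in X$, then $N_i^k \in X$. By convention, $N_\infty(C_{p^{-1}})$ is the one-element set $\{\emptyset\}$. *)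

theory Defs
  imports Complex_Main "HOL-Computational_Algebra.Primes"
begin

text \<open>\<open>Norm i j\<close> is the symbol \<open>N_i^j\<close>, a norm map from \<open>C_{p^i}\<close> to \<open>C_{p^j}\<close>.\<close>

datatype norm_symbol = Norm nat nat

definition norm_symbols :: "nat \<Rightarrow> norm_symbol set" where
  "norm_symbols n = {Norm i j | i j. i < j \<and> j \<le> n}"

definition restriction_closed :: "norm_symbol set \<Rightarrow> bool" where
  "restriction_closed X \<longleftrightarrow>
     (\<forall>i j k. Norm i j \<in> X \<and> i < k \<and> k < j \<longrightarrow> Norm i k \<in> X)"

definition composition_closed :: "norm_symbol set \<Rightarrow> bool" where
  "composition_closed X \<longleftrightarrow>
     (\<forall>i j k. Norm i j \<in> X \<and> Norm j k \<in> X \<longrightarrow> Norm i k \<in> X)"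

definition transfer_system :: "nat \<Rightarrow> norm_symbol set \<Rightarrow> bool" where
  "transfer_system n X \<longleftrightarrow>
     X \<subseteq> norm_symbols n \<and> restriction_closed X \<and> composition_closed X"

text \<open>
  \<open>N_infty_C p n\<close> is the set \<open>N_\<infinity>(C_{p^n})\<close>, for integers \<open>n \<ge> -1\<close>; the value
  at \<open>n = -1\<close> is a convention, and values at \<open>n < -1\<close> are meaningless.  The description by
  norm maps only mentions the exponents of the subgroups \<open>C_{p^i}\<close>, so the right-hand side
  does not involve \<open>p\<close>.
\<close>

definition N_infty_C :: "nat \<Rightarrow> int \<Rightarrow> norm_symbol set set" where
  "N_infty_C p n = (if n = - 1 then {{}} else {X. transfer_system (nat n) X})"

definition Cat :: "nat \<Rightarrow> real" where
  "Cat m = fact (2 * m) / (fact (m + 1) * fact m)"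

end

theory Submission
  imports Defs "HOL-Computational_Algebra.Formal_Power_Series"
begin

text \<open>
  Restriction says that the norms out of \<open>0\<close> are exactly \<open>N_0^1, \<dots>, N_0^i\<close> for some
  \<open>i \<le> n\<close>. Composition then forbids norms from \<open>{1, \<dots>, i}\<close> to \<open>{i + 1, \<dots>, n}\<close>, so the
  transfer system splits into two arbitrary ones, on \<open>{1, \<dots>, i}\<close> and on
  \<open>{i + 1, \<dots>, n}\<close>; this gives the recurrence. If \<open>c\<close> is the generating function, the
  recurrence reads \<open>c = 1 + X c\<^sup>2\<close>, so \<open>y = 1 - 2 X c\<close> satisfies \<open>y\<^sup>2 = 1 - 4 X\<close>.
  Differentiating gives \<open>(1 - 4 X) y' = - 2 y\<close>, a first-order recurrence for the
  coefficients which the Catalan numbers satisfy.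
\<close>

section \<open>Splitting transfer systems\<close>

text \<open>
  Indexing by the number \<open>m\<close> of points \<open>0, \<dots>, m - 1\<close> makes the conventional value at
  \<open>n = - 1\<close> the case \<open>m = 0\<close>.
\<close>

definition systems :: "nat \<Rightarrow> norm_symbol set set" where
  "systems m = {X. (\<forall>i j. Norm i j \<in> X \<longrightarrow> i < j \<and> j < m) \<and>
     restriction_closed X \<and> composition_closed X}"

text \<open>Restriction is given with \<open>k \<le> j\<close>, which absorbs the trivial case
  \<open>k = j\<close>.\<close>

lemma systemsD:
  assumes "X \<in> systems m"
  shows "Norm i j \<in> X \<Longrightarrow> i < j" "Norm i j \<in> X \<Longrightarrow> j < m"
    and "Norm i j \<in> X \<Longrightarrow> i < k \<Longrightarrow> k \<le> j \<Longrightarrow> Norm i k \<in> X"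
    and "Norm i j \<in> X \<Longrightarrow> Norm j k \<in> X \<Longrightarrow> Norm i k \<in> X"
  using assms unfolding systems_def restriction_closed_def composition_closed_def le_less
  by blast+

lemma systemsI:
  assumes "\<And>i j. Norm i j \<in> X \<Longrightarrow> i < j \<and> j < m"
    and "\<And>i j k. Norm i j \<in> X \<Longrightarrow> i < k \<Longrightarrow> k < j \<Longrightarrow> Norm i k \<in> X"
    and "\<And>i j k. Norm i j \<in> X \<Longrightarrow> Norm j k \<in> X \<Longrightarrow> Norm i k \<in> X"
  shows "X \<in> systems m"
  using assms unfolding systems_def restriction_closed_def composition_closed_def by blast

lemma norm_set_eqI:
  assumes "\<And>i j. Norm i j \<in> X \<longleftrightarrow> Norm i j \<in> Y"
  shows "X = Y"
proof (rule set_eqI)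
  show "x \<in> X \<longleftrightarrow> x \<in> Y" for x using assms by (cases x) simp
qed

lemma systems_0: "systems 0 = {{}}"
proof -
  have "X = {}" if "X \<in> systems 0" for X
    by (rule norm_set_eqI) (use systemsD(2)[OF that] in auto)
  moreover have "{} \<in> systems 0"
    by (rule systemsI) auto
  ultimately show ?thesis by blast
qed

lemma finite_systems: "finite (systems m)"
proof (rule finite_subset)
  show "systems m \<subseteq> Pow (case_prod Norm ` ({..<m} \<times> {..<m}))"
  proof clarify
    fix X x assume "X \<in> systems m" "x \<in> X"
    then show "x \<in> case_prod Norm ` ({..<m} \<times> {..<m})"
      using systemsD(1,2)[of X m] by (cases x) force
  qed
qed simp

lemma N_infty_C_eq_systems:
  assumes "n \<ge> - 1"
  shows "N_infty_C p n = systems (nat (n + 1))"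
proof (cases "n = - 1")
  case True
  then show ?thesis by (simp add: N_infty_C_def systems_0)
next
  case False
  then have "nat (n + 1) = Suc (nat n)" using assms by simp
  moreover have "X \<subseteq> norm_symbols k \<longleftrightarrow> (\<forall>i j. Norm i j \<in> X \<longrightarrow> i < j \<and> j < Suc k)" for X k
    unfolding norm_symbols_def less_Suc_eq_le subset_iff
    by (auto, metis norm_symbol.exhaust)
  then have "transfer_system k X \<longleftrightarrow> X \<in> systems (Suc k)" for k X
    unfolding transfer_system_def systems_def by blast
  ultimately show ?thesis using False by (auto simp: N_infty_C_def)
qed

text \<open>\<open>A\<close> is shifted by 1 onto the points 1 to \<open>i\<close>, and
  \<open>B\<close> by \<open>i + 1\<close> onto the points above \<open>i\<close>; the new least
  point 0 reaches exactly the block of \<open>A\<close>.\<close>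

definition glue :: "nat \<Rightarrow> norm_symbol set \<Rightarrow> norm_symbol set \<Rightarrow> norm_symbol set" where
  "glue i A B = {Norm 0 b | b. 0 < b \<and> b \<le> i} \<union> {Norm (Suc a) (Suc b) | a b. Norm a b \<in> A}
     \<union> {Norm (Suc (a + i)) (Suc (b + i)) | a b. Norm a b \<in> B}"

lemma glue_0: "Norm 0 b \<in> glue i A B \<longleftrightarrow> 0 < b \<and> b \<le> i"
  by (auto simp: glue_def)

lemma glue_low:
  assumes "A \<in> systems i" "a < i"
  shows "Norm (Suc a) b \<in> glue i A B \<longleftrightarrow> 0 < b \<and> Norm a (b - 1) \<in> A"
  using assms by (cases b) (auto simp: glue_def)

text \<open>Norms of \<open>A\<close> start below \<open>i\<close>, so a source above
  \<open>i\<close> can only come from \<open>B\<close>. As \<open>B\<close> is arbitrary, the guard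
  \<open>i < b\<close> excludes truncated values of \<open>b - Suc i\<close>.\<close>

lemma glue_high:
  assumes "A \<in> systems i"
  shows "Norm (Suc (a + i)) b \<in> glue i A B \<longleftrightarrow> i < b \<and> Norm a (b - Suc i) \<in> B"
proof -
  have "Norm (a + i) c \<notin> A" for c
    using systemsD(1,2)[OF assms, of "a + i" c] by auto
  moreover have "i < b \<longleftrightarrow> (\<exists>c. b = Suc (c + i))"
    by (metis add.commute less_add_Suc2 less_imp_Suc_add add_Suc)
  ultimately show ?thesis by (auto simp: glue_def)
qed

lemma point_cases:
  fixes a i :: nat
  obtains "a = 0" | c where "a = Suc c" "c < i" | c where "a = Suc (c + i)"
proof (cases a)
  case (Suc c)
  then show ?thesis
    using that(2)[of c] that(3)[of "c - i"] by (cases "c < i") auto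
qed (use that in blast)

text \<open>A norm out of a positive point stays in the block of that point, where the laws of
  \<open>A\<close> or \<open>B\<close> apply. A norm out of 0 ends in the low block, so composing it
  with another norm ends there too.\<close>

lemma glue_systems:
  assumes "i \<le> m" "A \<in> systems i" "B \<in> systems (m - i)"
  shows "glue i A B \<in> systems (Suc m)"
proof (rule systemsI)
  note A = systemsD[OF assms(2)] and B = systemsD[OF assms(3)]
  note low = glue_low[OF assms(2)] and high = glue_high[OF assms(2)]
  fix a b assume ab: "Norm a b \<in> glue i A B"
  show "a < b \<and> b < Suc m"
  proof (cases a rule: point_cases[where i = i])
    case 1 then show ?thesis using ab assms(1) by (auto simp: glue_0)
  next
    case (2 c) then show ?thesis using ab A(1,2)[of c "b - 1"] assms(1) by (auto simp: low)
  next
    case (3 c) then show ?thesis using ab B(1,2)[of c "b - Suc i"] assms(1) by (auto simp: high)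
  qed
  fix k
  show "Norm a k \<in> glue i A B" if k: "a < k" "k < b"
  proof (cases a rule: point_cases[where i = i])
    case 1 then show ?thesis using ab k by (auto simp: glue_0)
  next
    case (2 c) then show ?thesis using ab k A(3)[of c "b - 1" "k - 1"] by (auto simp: low)
  next
    case (3 c) then show ?thesis using ab k B(3)[of c "b - Suc i" "k - Suc i"] by (auto simp: high)
  qed
  show "Norm a k \<in> glue i A B" if bk: "Norm b k \<in> glue i A B"
  proof (cases a rule: point_cases[where i = i])
    case 1
    then have "0 < b" "b \<le> i" using ab by (auto simp: glue_0)
    then obtain c where c: "b = Suc c" "c < i" by (metis Suc_le_eq gr0_implies_Suc)
    then have "0 < k" "Norm c (k - 1) \<in> A" using bk low by auto
    then show ?thesis using A(2)[of c "k - 1"] 1 by (auto simp: glue_0)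
  next
    case (2 c)
    then have *: "0 < b" "Norm c (b - 1) \<in> A" using ab by (auto simp: low)
    then obtain d where d: "b = Suc d" "d < i" using A(2)[of c "b - 1"] by (metis Suc_pred' )
    then have "0 < k" "Norm d (k - 1) \<in> A" using bk low by auto
    then show ?thesis using A(4)[of c d "k - 1"] * 2 d by (auto simp: low)
  next
    case (3 c)
    then have *: "i < b" "Norm c (b - Suc i) \<in> B" using ab by (auto simp: high)
    \<comment> \<open>Since \<open>i < b\<close>, the truncated subtraction is exact.\<close>
    then have b: "b = Suc ((b - Suc i) + i)" by simp
    have "i < k" "Norm (b - Suc i) (k - Suc i) \<in> B" using bk high[of "b - Suc i" k] b by auto
    then show ?thesis using B(4)[of c "b - Suc i" "k - Suc i"] * 3 by (auto simp: high)
  qed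
qed

text \<open>The norms out of 0 determine \<open>i\<close>; undoing the shifts then recovers
  \<open>A\<close> and \<open>B\<close>.\<close>

lemma glue_inj:
  assumes "A \<in> systems i" "A' \<in> systems i'"
    and eq: "glue i A B = glue i' A' B'"
  shows "i = i'" "A = A'" "B = B'"
proof -
  have "0 < b \<and> b \<le> i \<longleftrightarrow> 0 < b \<and> b \<le> i'" for b
    using eq glue_0 by metis
  from this[of i] this[of i'] show i: "i = i'" by auto
  show "A = A'"
  proof (rule norm_set_eqI)
    fix a b
    show "Norm a b \<in> A \<longleftrightarrow> Norm a b \<in> A'"
    proof (cases "a < i")
      case True
      then show ?thesis
        using glue_low[of A i a "Suc b" B] glue_low[of A' i a "Suc b" B'] assms i by simp
    next
      case False
      then show ?thesis using systemsD(1,2)[OF assms(1), of a b] systemsD(1,2)[OF assms(2), of a b] i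
        by auto
    qed
  qed
  show "B = B'"
  proof (rule norm_set_eqI)
    show "Norm a b \<in> B \<longleftrightarrow> Norm a b \<in> B'" for a b
      using glue_high[of A i a "Suc (b + i)" B] glue_high[of A' i a "Suc (b + i)" B'] assms i by simp
  qed
qed

text \<open>Surjectivity of gluing: cut at the largest target of a norm out of 0.\<close>

lemma systems_Suc_glue:
  assumes X: "X \<in> systems (Suc m)"
  obtains i A B where "i \<le> m" "A \<in> systems i" "B \<in> systems (m - i)" "X = glue i A B"
proof -
  note D = systemsD[OF X]
  \<comment> \<open>Inserting 0 gives \<open>i = 0\<close> when no norm leaves 0.\<close>
  define i where "i = Max (insert 0 {j. Norm 0 j \<in> X})"
  have fin: "finite (insert 0 {j. Norm 0 j \<in> X})"
    by (rule finite_subset[of _ "{..m}"]) (use D(2) in \<open>auto simp: less_Suc_eq_le\<close>)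
  have "i \<in> insert 0 {j. Norm 0 j \<in> X}"
    unfolding i_def by (rule Max_in[OF fin]) simp
  moreover have "j \<le> i" if "Norm 0 j \<in> X" for j
    unfolding i_def using Max_ge[OF fin] that by simp
  ultimately have i: "Norm 0 j \<in> X \<longleftrightarrow> 0 < j \<and> j \<le> i" for j
    using D(1)[of 0 j] D(3)[of 0 i j] by auto
  have im: "i \<le> m" using i[of i] D(2)[of 0 i] by (cases "i = 0") auto
  \<comment> \<open>Norms go upwards, so bounding the target by \<open>b < i\<close> also puts the
    source in the low block.\<close>
  define A where "A = {Norm a b | a b. Norm (Suc a) (Suc b) \<in> X \<and> b < i}"
  define B where "B = {Norm a b | a b. Norm (Suc (a + i)) (Suc (b + i)) \<in> X}"
  have memA: "Norm a b \<in> A \<longleftrightarrow> Norm (Suc a) (Suc b) \<in> X \<and> b < i" for a b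
    by (auto simp: A_def)
  have memB: "Norm a b \<in> B \<longleftrightarrow> Norm (Suc (a + i)) (Suc (b + i)) \<in> X" for a b
    by (auto simp: B_def)
  have A: "A \<in> systems i"
  proof (rule systemsI)
    show "a < b \<and> b < i" if "Norm a b \<in> A" for a b
      using D(1)[of "Suc a" "Suc b"] that memA by auto
    show "Norm a k \<in> A" if "Norm a b \<in> A" "a < k" "k < b" for a b k
      using D(3)[of "Suc a" "Suc b" "Suc k"] that memA by auto
    show "Norm a k \<in> A" if "Norm a b \<in> A" "Norm b k \<in> A" for a b k
      using D(4) that memA by blast
  qed
  have B: "B \<in> systems (m - i)"
  proof (rule systemsI)
    show "a < b \<and> b < m - i" if "Norm a b \<in> B" for a b
      using D(1,2)[of "Suc (a + i)" "Suc (b + i)"] that memB im by auto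
    show "Norm a k \<in> B" if "Norm a b \<in> B" "a < k" "k < b" for a b k
      using D(3)[of "Suc (a + i)" "Suc (b + i)" "Suc (k + i)"] that memB by auto
    show "Norm a k \<in> B" if "Norm a b \<in> B" "Norm b k \<in> B" for a b k
      using D(4) that memB by blast
  qed
  have "X = glue i A B"
  proof (rule norm_set_eqI)
    fix a b
    show "Norm a b \<in> X \<longleftrightarrow> Norm a b \<in> glue i A B"
    proof (cases a rule: point_cases[where i = i])
      case 1 then show ?thesis by (simp add: i glue_0)
    next
      case (2 c)
      \<comment> \<open>Composing this norm with one from \<open>a\<close> to \<open>b\<close> gives
        a norm from 0 to \<open>b\<close>, hence \<open>b \<le> i\<close>: nothing leaves the low
        block.\<close>
      then have "Norm 0 a \<in> X" by (simp add: i)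
      then have "b \<le> i" if "Norm a b \<in> X" using D(4) that i by blast
      then show ?thesis using 2 D(1)[of a b] by (cases b) (auto simp: glue_low[OF A] memA)
    next
      case (3 c)
      then show ?thesis using D(1)[of a b] by (auto simp: glue_high[OF A] memB)
    qed
  qed
  then show ?thesis using that im A B by blast
qed

lemma card_systems_Suc:
  "card (systems (Suc m)) = (\<Sum>i\<le>m. card (systems i) * card (systems (m - i)))"
proof -
  let ?D = "SIGMA i:{..m}. systems i \<times> systems (m - i)"
  have "bij_betw (\<lambda>(i, A, B). glue i A B) ?D (systems (Suc m))"
  proof (rule bij_betw_imageI)
    show "inj_on (\<lambda>(i, A, B). glue i A B) ?D"
      by (rule inj_onI) (auto dest: glue_inj)
    show "(\<lambda>(i, A, B). glue i A B) ` ?D = systems (Suc m)"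
    proof (intro equalityI subsetI)
      fix X assume "X \<in> systems (Suc m)"
      then obtain i A B where "i \<le> m" "A \<in> systems i" "B \<in> systems (m - i)" "X = glue i A B"
        by (rule systems_Suc_glue)
      then show "X \<in> (\<lambda>(i, A, B). glue i A B) ` ?D"
        by (intro image_eqI[of _ _ "(i, A, B)"]) auto
    qed (auto intro: glue_systems)
  qed
  then have "card (systems (Suc m)) = card ?D"
    by (simp add: bij_betw_same_card)
  also have "\<dots> = (\<Sum>i\<le>m. card (systems i) * card (systems (m - i)))"
    by (simp add: card_SigmaI finite_systems card_cartesian_product)
  finally show ?thesis .
qed

section \<open>The Catalan recurrence\<close>

lemma Cat_Suc: "real (m + 2) * Cat (Suc m) = real (4 * m + 2) * Cat m"
proof -
  have "fact (2 * Suc m) = (2 * real m + 2) * (2 * real m + 1) * fact (2 * m)"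
    by (simp add: algebra_simps)
  moreover have "fact (Suc m + 1) = (real m + 2) * fact (m + 1)"
    by (simp add: algebra_simps)
  moreover have "fact (Suc m) = (real m + 1) * fact m"
    by (simp add: algebra_simps)
  ultimately have "Cat (Suc m) = ((2 * real m + 2) * (2 * real m + 1) * fact (2 * m)) /
      ((real m + 2) * fact (m + 1) * ((real m + 1) * fact m))"
    by (simp only: Cat_def)
  also have "\<dots> = (4 * real m + 2) / (real m + 2) * Cat m"
  proof -
    \<comment> \<open>The factorials are abstracted to \<open>x\<close>, \<open>y\<close>,
      \<open>z\<close>, leaving a field identity in which \<open>2 * a + 2\<close> cancels against
      \<open>a + 1\<close>.\<close>
    have "(2 * a + 2) * (2 * a + 1) * x / ((a + 2) * y * ((a + 1) * z)) =
        (4 * a + 2) / (a + 2) * (x / (y * z))" if "a \<ge> 0" "y \<noteq> 0" "z \<noteq> 0" for a x y z :: real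
    proof -
      have "a + 1 \<noteq> 0" "a + 2 \<noteq> 0" using that(1) by auto
      then show ?thesis using that(2,3) by (simp add: divide_simps) (simp add: algebra_simps)
    qed
    then show ?thesis unfolding Cat_def by (metis fact_nonzero of_nat_0_le_iff)
  qed
  finally have "Cat (Suc m) * (real m + 2) = (4 * real m + 2) * Cat m"
    by (simp add: divide_simps)
  then show ?thesis by (simp add: algebra_simps)
qed

lemma convolution_recurrence_Cat:
  fixes c :: "nat \<Rightarrow> real"
  assumes c0: "c 0 = 1" and cSuc: "\<And>m. c (Suc m) = (\<Sum>i\<le>m. c i * c (m - i))"
  shows "c m = Cat m"
proof -
  define C where "C = Abs_fps c"
  have C: "C = 1 + fps_X * C\<^sup>2"
  proof (rule fps_ext)
    show "fps_nth C n = fps_nth (1 + fps_X * C\<^sup>2) n" for n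
      by (cases n) (simp_all add: C_def c0 cSuc power2_eq_square fps_mult_nth[of "Abs_fps c"]
          atLeast0AtMost)
  qed
  \<comment> \<open>\<open>C\<close> is a root of the quadratic X T^2 - T + 1 in T; \<open>y\<close>
    is minus its derivative at \<open>C\<close>, hence a square root of the discriminant.\<close>
  define y where "y = 1 - 2 * fps_X * C"
  have "y\<^sup>2 = 1 - 4 * fps_X * (C - fps_X * C\<^sup>2)"
    by (simp add: y_def power2_eq_square algebra_simps)
  also have "C - fps_X * C\<^sup>2 = 1"
    using C by (metis add_diff_cancel_right')
  finally have y2: "y\<^sup>2 = 1 - 4 * fps_X" by simp
  then have "fps_deriv (y\<^sup>2) = - 4" by simp
  then have "2 * (y * fps_deriv y) = 2 * (- 2)"
    by (simp add: power2_eq_square algebra_simps)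
  then have "y * fps_deriv y = - 2"
    by (metis mult_cancel_left zero_neq_numeral)
  \<comment> \<open>Multiply by \<open>y\<close> and replace \<open>y * y\<close> by the
    discriminant.\<close>
  then have ode: "(1 - 4 * fps_X) * fps_deriv y = - 2 * y"
    unfolding y2[symmetric] power2_eq_square by (metis mult.assoc mult.commute)
  have rec: "real (m + 2) * c (Suc m) = real (4 * m + 2) * c m" for m
  proof -
    have y_nth: "fps_nth y (Suc n) = - 2 * c n" for n
      by (simp add: y_def C_def mult.assoc numeral_fps_const)
    \<comment> \<open>At index \<open>Suc m\<close> only the coefficients of \<open>y\<close> at
      \<open>m + 1\<close> and \<open>m + 2\<close> occur, so \<open>y_nth\<close> applies and the
      constant term of \<open>y\<close> is avoided.\<close>
    have "fps_nth ((1 - 4 * fps_X) * fps_deriv y) (Suc m) = fps_nth (- 2 * y) (Suc m)"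
      by (simp only: ode)
    then show ?thesis
      by (simp add: y_nth left_diff_distrib mult.assoc numeral_fps_const fps_const_neg algebra_simps
          del: fps_const_neg)
  qed
  show ?thesis
  proof (induction m)
    case 0
    show ?case by (simp add: c0 Cat_def)
  next
    case (Suc m)
    then have "real (m + 2) * c (Suc m) = real (m + 2) * Cat (Suc m)"
      using rec Cat_Suc by simp
    then show ?case by (simp del: of_nat_add)
  qed
qed

theorem theorem20:
  fixes p :: nat
  assumes "prime p"
  shows "card (N_infty_C p (- 1)) = 1
    \<and> (\<forall>n::int. n \<ge> 0 \<longrightarrow>
         card (N_infty_C p n) =
           (\<Sum>i=0..n. card (N_infty_C p (i - 1)) * card (N_infty_C p (n - i - 1))))
    \<and> (\<forall>n::int. n \<ge> - 1 \<longrightarrow> real (card (N_infty_C p n)) = Cat (nat (n + 1)))"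
proof (intro conjI allI impI)
  show "card (N_infty_C p (- 1)) = 1"
    by (simp add: N_infty_C_def)
next
  fix n :: int
  assume "n \<ge> 0"
  then obtain m where n: "n = int m" by (metis nonneg_int_cases)
  have "card (N_infty_C p n) = (\<Sum>k\<le>m. card (systems k) * card (systems (m - k)))"
    by (simp add: n N_infty_C_eq_systems nat_add_distrib card_systems_Suc)
  also have "\<dots> = (\<Sum>i=0..n. card (N_infty_C p (i - 1)) * card (N_infty_C p (n - i - 1)))"
    \<comment> \<open>The exponents \<open>i - 1\<close> and \<open>n - i - 1\<close> correspond to
      \<open>i\<close> and \<open>n - i\<close> points; the convention at \<open>- 1\<close> serves
      the two end terms.\<close>
    by (rule sum.reindex_bij_witness[of _ nat int])
      (auto simp: n N_infty_C_eq_systems nat_diff_distrib)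
  finally show "card (N_infty_C p n) = \<dots>" .
next
  fix n :: int
  assume "n \<ge> - 1"
  then have "real (card (N_infty_C p n)) = real (card (systems (nat (n + 1))))"
    by (simp add: N_infty_C_eq_systems)
  also have "\<dots> = Cat (nat (n + 1))"
    by (rule convolution_recurrence_Cat) (simp_all add: systems_0 card_systems_Suc)
  finally show "real (card (N_infty_C p n)) = Cat (nat (n + 1))" .
qed

end
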